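(* Let $S=\langle g_1,\dots,g_\nu\rangle$ be a numerical semigroup minimally generated by $m=g_1<g_2<\dots<g_\nu$, with Frobenius number $f$. The following conditions are equivalent: (i) $\mathrm{Ap}(S)$ is $\gamma$-rectangular; (ii) $f+m=\sum_{i=2}^{\nu}\gamma_ig_i$; (iii) $m=\prod_{i=2}^{\nu}(\gamma_i+1)$.
   Context: A numerical semigroup is a submonoid $S$ of $(\mathbb N,+)$, $0\in\mathbb N$, with finite complement in $\mathbb N$. Its multiplicity $m=g_1$ is the least positive element of $S$, and its Frobenius number is $f=\max\{z\in\mathbb Z : z\notin S\}$. The Apéry set is $\mathrm{Ap}(S)=\{\omega\in S : \omega-m\notin S\}$, i.e. the set of smallest elements of $S$ in each congruence class modulo $m$. Let $M=S\setminus\{0\}$, $hM=M+\dots+M$ ($h$ summands), $0M=S$. The order $\mathrm{ord}(s)$ of $s\in S$ is the unique $h\in\mathbb N$ with $s\in hM\setminus(h+1)M$. A representation of $s\in S$ is an expression $s=\lambda_1g_1+\dots+\lambda_\nu g_\nu$ with $\lambda_i\in\mathbb N$; it is maximal if $\lambda_1+\dots+\lambda_\nu=\mathrm{ord}(s)$. For $i=2,\dots,\nu$ let $\gamma_i=\max\{h\in\mathbb N : hg_i\in\mathrm{Ap}(S),\ \mathrm{ord}(hg_i)=h \text{ and } hg_i \text{ has a unique maximal representation}\}$. Let $\Gamma=\{\sum_{i=2}^\nu\lambda_ig_i : 0\le\lambda_i\le\gamma_i\}$. $\mathrm{Ap}(S)$ is called $\gamma$-rectangular if $\mathrm{Ap}(S)=\Gamma$.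 *)

theory Defs
  imports Complex_Main "HOL-Library.FuncSet"
begin

definition numerical_semigroup :: "nat set \<Rightarrow> bool" where
  "numerical_semigroup S \<longleftrightarrow>
     0 \<in> S \<and> (\<forall>x\<in>S. \<forall>y\<in>S. x + y \<in> S) \<and> finite (UNIV - S)"

definition sgp_multiplicity :: "nat set \<Rightarrow> nat" where
  "sgp_multiplicity S = (LEAST x. x \<in> S \<and> 0 < x)"

text \<open>The maximum is taken over the integers, so that the value for the semigroup of all
  natural numbers is \<open>- 1\<close>.\<close>

definition frobenius :: "nat set \<Rightarrow> int" where
  "frobenius S = (GREATEST z. z \<notin> int ` S)"

definition apery :: "nat set \<Rightarrow> nat set" where
  "apery S = {w \<in> S. int w - int (sgp_multiplicity S) \<notin> int ` S}"

definition generated :: "(nat \<Rightarrow> nat) \<Rightarrow> nat set \<Rightarrow> nat set" where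
  "generated g I = {\<Sum>i\<in>I. l i * g i | l. True}"

text \<open>Generators are indexed by \<open>1, \<dots>, n\<close>; values of \<open>g\<close> at other indices are irrelevant.\<close>

definition minimally_generated :: "nat set \<Rightarrow> (nat \<Rightarrow> nat) \<Rightarrow> nat \<Rightarrow> bool" where
  "minimally_generated S g n \<longleftrightarrow>
     S = generated g {1..n} \<and> (\<forall>J. J \<subset> {1..n} \<longrightarrow> generated g J \<noteq> S)"

text \<open>The set \<open>hM\<close> of sums of \<open>h\<close> elements of \<open>M = S - {0}\<close>, with the convention \<open>0M = S\<close>.\<close>

definition fold_sum :: "nat set \<Rightarrow> nat \<Rightarrow> nat set" where
  "fold_sum S h =
     (if h = 0 then S else {\<Sum>j<h. x j | x. \<forall>j<h. x j \<in> S - {0}})"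

definition sgp_ord :: "nat set \<Rightarrow> nat \<Rightarrow> nat" where
  "sgp_ord S s = (THE h. s \<in> fold_sum S h - fold_sum S (h + 1))"

text \<open>Coefficient vectors are extensional functions on \<open>{1..n}\<close>, so that uniqueness of a
  representation is uniqueness of its coefficients.\<close>

definition representation :: "(nat \<Rightarrow> nat) \<Rightarrow> nat \<Rightarrow> nat \<Rightarrow> (nat \<Rightarrow> nat) \<Rightarrow> bool" where
  "representation g n s l \<longleftrightarrow>
     l \<in> {1..n} \<rightarrow>\<^sub>E UNIV \<and> s = (\<Sum>i=1..n. l i * g i)"

definition maximal_representation ::
    "nat set \<Rightarrow> (nat \<Rightarrow> nat) \<Rightarrow> nat \<Rightarrow> nat \<Rightarrow> (nat \<Rightarrow> nat) \<Rightarrow> bool" where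
  "maximal_representation S g n s l \<longleftrightarrow>
     representation g n s l \<and> (\<Sum>i=1..n. l i) = sgp_ord S s"

definition gamma :: "nat set \<Rightarrow> (nat \<Rightarrow> nat) \<Rightarrow> nat \<Rightarrow> nat \<Rightarrow> nat" where
  "gamma S g n i =
     Max {h. h * g i \<in> apery S \<and> sgp_ord S (h * g i) = h \<and>
             (\<exists>!l. maximal_representation S g n (h * g i) l)}"

definition Gamma_set :: "nat set \<Rightarrow> (nat \<Rightarrow> nat) \<Rightarrow> nat \<Rightarrow> nat set" where
  "Gamma_set S g n =
     {\<Sum>i=2..n. l i * g i | l. \<forall>i\<in>{2..n}. l i \<le> gamma S g n i}"

definition gamma_rectangular :: "nat set \<Rightarrow> (nat \<Rightarrow> nat) \<Rightarrow> nat \<Rightarrow> bool" where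
  "gamma_rectangular S g n \<longleftrightarrow> apery S = Gamma_set S g n"

end

theory Submission
  imports Defs
begin

text \<open>Among the maximal representations of an element of the Ap\'ery set, consider those that
  maximise \<open>\<Sum> l\<^sub>i g\<^sub>i\<^sup>2\<close>. If such a representation had \<open>l\<^sub>i > \<gamma>\<^sub>i\<close>, then
  \<open>(\<gamma>\<^sub>i + 1) g\<^sub>i\<close> would have a second maximal representation, and substituting it would increase
  the quadratic weight by strict convexity. Hence these representations have \<open>l\<^sub>i \<le> \<gamma>\<^sub>i\<close>, and
  \<open>Ap(S) \<subseteq> \<Gamma>\<close>. Since the Ap\'ery set has maximum \<open>f + m\<close> and cardinality \<open>m\<close>, while \<open>\<Gamma>\<close> has
  maximum \<open>\<Sum> \<gamma>\<^sub>i g\<^sub>i\<close> and cardinality at most \<open>\<Prod> (\<gamma>\<^sub>i + 1)\<close>, it only remains to show that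
  the sums \<open>\<Sum> l\<^sub>i g\<^sub>i\<close> are distinct if \<open>Ap(S) = \<Gamma>\<close>. In that case \<open>\<gamma>\<close> is the only representation
  of \<open>\<Sum> \<gamma>\<^sub>i g\<^sub>i\<close> of greatest weight; if \<open>l\<close> and \<open>k\<close> had the same sum and \<open>k\<close> had at least the
  weight of \<open>l\<close>, then \<open>\<gamma> - l + k\<close> would be another one.\<close>

locale generated_semigroup =
  fixes S :: "nat set" and g :: "nat \<Rightarrow> nat" and n :: nat
  assumes sgp: "numerical_semigroup S"
    and mono: "strict_mono_on {1..n} g"
    and gen: "minimally_generated S g n"
begin

section \<open>Coefficient vectors and elementary properties of the generators\<close>

abbreviation m :: nat where "m \<equiv> sgp_multiplicity S"
abbreviation c :: "nat \<Rightarrow> nat" where "c \<equiv> gamma S g n"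

text \<open>Arbitrary functions serve as coefficient vectors and their values outside
  \<open>{1..n}\<close> are ignored, so vectors can be added and subtracted freely. Extensionality
  returns only where vectors are counted or representations must be unique.\<close>

definition val :: "(nat \<Rightarrow> nat) \<Rightarrow> nat" where "val l = (\<Sum>i=1..n. l i * g i)"
definition len :: "(nat \<Rightarrow> nat) \<Rightarrow> nat" where "len l = (\<Sum>i=1..n. l i)"
definition weight :: "(nat \<Rightarrow> nat) \<Rightarrow> nat" where "weight l = (\<Sum>i=1..n. l i * (g i)\<^sup>2)"

lemma val_add: "val (\<lambda>i. a i + b i) = val a + val b"
  and len_add: "len (\<lambda>i. a i + b i) = len a + len b"
  and weight_add: "weight (\<lambda>i. a i + b i) = weight a + weight b"
  by (simp_all add: val_def len_def weight_def sum.distrib distrib_right)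

lemma val_zero: "val (\<lambda>_. 0) = 0" and len_zero: "len (\<lambda>_. 0) = 0"
  by (simp_all add: val_def len_def)

lemma
  assumes "\<And>i. i \<in> {1..n} \<Longrightarrow> a i = b i"
  shows val_cong: "val a = val b" and len_cong: "len a = len b" and weight_cong: "weight a = weight b"
  using assms by (simp_all add: val_def len_def weight_def)

lemma
  assumes "\<And>i. i \<in> {1..n} \<Longrightarrow> b i \<le> a i"
  shows val_diff: "val (\<lambda>i. a i - b i) + val b = val a"
    and len_diff: "len (\<lambda>i. a i - b i) + len b = len a"
    and weight_diff: "weight (\<lambda>i. a i - b i) + weight b = weight a"
  unfolding val_add [symmetric] len_add [symmetric] weight_add [symmetric]
  using assms by (intro val_cong len_cong weight_cong; simp)+

lemma
  assumes "i \<in> {1..n}"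
  shows val_single: "val (\<lambda>j. if j = i then h else 0) = h * g i"
    and len_single: "len (\<lambda>j. if j = i then h else 0) = h"
    and weight_single: "weight (\<lambda>j. if j = i then h else 0) = h * (g i)\<^sup>2"
  using assms by (simp_all add: val_def len_def weight_def if_distrib [of "\<lambda>x. x * _"] cong: if_cong)

lemma S_eq: "S = range val"
  using gen by (auto simp: minimally_generated_def generated_def val_def)

lemma val_in_S [simp]: "val l \<in> S"
  by (simp add: S_eq)

lemma S_add: "x \<in> S \<Longrightarrow> y \<in> S \<Longrightarrow> x + y \<in> S"
  and S_cofinite: "finite (UNIV - S)"
  using sgp by (auto simp: numerical_semigroup_def)

lemma S_unbounded: "\<exists>x\<in>S. N \<le> x"
proof -
  have "infinite S"
    using S_cofinite by (metis Diff_infinite_finite infinite_UNIV_nat)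
  then show ?thesis
    by (meson finite_nat_set_iff_bounded not_le)
qed

lemma n_pos: "1 \<le> n"
proof (rule ccontr)
  assume "\<not> 1 \<le> n"
  then have "S = {0}"
    by (auto simp: S_eq val_def)
  then show False
    using S_unbounded [of 1] by auto
qed

text \<open>A zero generator could be dropped without changing the generated set, against
  minimality.\<close>

lemma g1_pos: "0 < g 1"
proof (rule ccontr)
  assume "\<not> 0 < g 1"
  then have "(\<Sum>i\<in>{2..n}. l i * g i) = (\<Sum>i\<in>{1..n}. l i * g i)" for l
    using n_pos by (intro sum.mono_neutral_left) (auto simp: Suc_le_eq le_less)
  then have "generated g {2..n} = S"
    using gen by (simp add: minimally_generated_def generated_def)
  moreover have "{2..n} \<subset> {1..n}"
    using n_pos by auto
  ultimately show False
    using gen by (auto simp: minimally_generated_def)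
qed

lemma g1_le: "i \<in> {1..n} \<Longrightarrow> g 1 \<le> g i"
  using mono n_pos by (cases "i = 1") (auto simp: strict_mono_on_def intro!: less_imp_le)

lemma g_pos: "i \<in> {1..n} \<Longrightarrow> 0 < g i"
  using g1_le g1_pos by (meson less_le_trans)

lemma g_inj: "i \<in> {1..n} \<Longrightarrow> j \<in> {1..n} \<Longrightarrow> g i = g j \<Longrightarrow> i = j"
  using strict_mono_on_imp_inj_on [OF mono] by (auto dest: inj_onD)

lemma g_in_S: "i \<in> {1..n} \<Longrightarrow> g i \<in> S"
  using val_in_S [of "\<lambda>j. if j = i then 1 else 0"] by (simp add: val_single)

lemma term_le_val: "i \<in> {1..n} \<Longrightarrow> l i * g i \<le> val l"
  unfolding val_def by (rule member_le_sum) auto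

lemma len_le_val: "len l \<le> val l"
  unfolding val_def len_def using g_pos by (intro sum_mono) (simp add: Suc_le_eq)

lemma len_pos: "val l \<noteq> 0 \<Longrightarrow> 0 < len l"
  by (auto simp: val_def len_def intro!: Nat.gr0I)

text \<open>A crude bound, enough for a representation of greatest weight to exist.\<close>

lemma weight_le: "weight l \<le> (val l)\<^sup>2"
proof -
  have "l i * (g i)\<^sup>2 \<le> l i * g i * val l" if i: "i \<in> {1..n}" for i
  proof (cases "l i = 0")
    case False
    then have "g i \<le> l i * g i"
      by simp
    also have "\<dots> \<le> val l"
      using i by (rule term_le_val)
    finally show ?thesis
      by (simp add: power2_eq_square)
  qed simp
  then have "weight l \<le> (\<Sum>i=1..n. l i * g i * val l)"
    unfolding weight_def by (rule sum_mono)
  then show ?thesis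
    by (simp add: val_def power2_eq_square sum_distrib_right)
qed

lemma multiplicity_eq: "m = g 1"
  unfolding sgp_multiplicity_def
proof (rule Least_equality)
  show "g 1 \<in> S \<and> 0 < g 1"
    using g_in_S [of 1] g1_pos n_pos by simp
next
  fix x assume x: "x \<in> S \<and> 0 < x"
  then obtain l where l: "x = val l"
    by (auto simp: S_eq)
  then have "(\<Sum>i=1..n. l i * g i) \<noteq> 0"
    using x [THEN conjunct2] unfolding val_def by linarith
  then obtain i where "i \<in> {1..n}" "l i * g i \<noteq> 0"
    by (meson sum.not_neutral_contains_not_neutral)
  then have i: "i \<in> {1..n}" "l i \<noteq> 0"
    by simp_all
  have "g 1 \<le> g i"
    using i by (intro g1_le)
  also have "\<dots> \<le> l i * g i"
    using i by simp
  finally show "g 1 \<le> x"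
    using term_le_val [OF i(1), of l] l by simp
qed

lemma m_pos: "0 < m" and m_in_S: "m \<in> S"
  using g1_pos g_in_S [of 1] n_pos by (simp_all add: multiplicity_eq)

subsection \<open>The order\<close>

lemma fold_sum_Suc:
  assumes "x \<in> fold_sum S h" "y \<in> S - {0}"
  shows "x + y \<in> fold_sum S (Suc h)"
proof (cases h)
  case 0
  then show ?thesis
    using assms S_add by (auto simp: fold_sum_def intro!: exI [of _ "\<lambda>_. x + y"])
next
  case Suc
  then obtain f where f: "x = (\<Sum>j<h. f j)" "\<forall>j<h. f j \<in> S - {0}"
    using assms by (auto simp: fold_sum_def)
  then show ?thesis
    using assms by (auto simp: fold_sum_def less_Suc_eq intro!: exI [of _ "f(h := y)"])
qed

lemma val_sum: "val (\<lambda>i. \<Sum>j<h. L j i) = (\<Sum>j<(h::nat). val (L j))"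
  and len_sum: "len (\<lambda>i. \<Sum>j<h. L j i) = (\<Sum>j<h. len (L j))"
  by (induction h) (simp_all add: val_add len_add val_zero len_zero)

text \<open>Each nonzero summand has a representation of length at least one, and these add up to
  one of length at least \<open>h\<close>; the inequality is needed because summands need not be
  generators. Conversely, generators are split off one at a time, the remainder staying in
  \<open>S\<close>.\<close>

lemma fold_sum_iff: "s \<in> fold_sum S h \<longleftrightarrow> (\<exists>l. val l = s \<and> h \<le> len l)"
proof
  assume s: "s \<in> fold_sum S h"
  show "\<exists>l. val l = s \<and> h \<le> len l"
  proof (cases "h = 0")
    case True
    then show ?thesis
      using s by (auto simp: fold_sum_def S_eq)
  next
    case False
    then obtain x where x: "s = (\<Sum>j<h. x j)" "\<And>j. j < h \<Longrightarrow> x j \<in> S - {0}"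
      using s by (auto simp: fold_sum_def)
    then have "\<forall>j. \<exists>l. j < h \<longrightarrow> val l = x j"
      unfolding S_eq by (metis DiffD1 imageE)
    then obtain L where L: "\<And>j. j < h \<Longrightarrow> val (L j) = x j"
      by metis
    have "1 \<le> len (L j)" if "j < h" for j
      using len_pos [of "L j"] L x that by (simp add: Suc_le_eq)
    then have "(\<Sum>j<h. 1) \<le> (\<Sum>j<h. len (L j))"
      by (intro sum_mono) auto
    then show ?thesis
      using L x by (intro exI [of _ "\<lambda>i. \<Sum>j<h. L j i"]) (simp add: val_sum len_sum)
  qed
next
  show "\<exists>l. val l = s \<and> h \<le> len l \<Longrightarrow> s \<in> fold_sum S h"
  proof (induction h arbitrary: s)
    case 0
    then show ?case
      by (auto simp: fold_sum_def)
  next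
    case (Suc h)
    then obtain l where l: "val l = s" "Suc h \<le> len l"
      by auto
    then have "(\<Sum>i=1..n. l i) \<noteq> 0"
      unfolding len_def by linarith
    then obtain i where i: "i \<in> {1..n}" "l i \<noteq> 0"
      by (meson sum.not_neutral_contains_not_neutral)
    let ?e = "\<lambda>j. if j = i then 1 else 0 :: nat"
    have "val (\<lambda>j. l j - ?e j) + val ?e = val l" "len (\<lambda>j. l j - ?e j) + len ?e = len l"
      using i by (auto intro!: val_diff len_diff)
    then have "s = val (\<lambda>j. l j - ?e j) + g i" "h \<le> len (\<lambda>j. l j - ?e j)"
      using l val_single [OF i(1), of 1] len_single [OF i(1), of 1] by auto
    then show ?case
      using fold_sum_Suc [OF Suc.IH, of "val (\<lambda>j. l j - ?e j)" "g i"] g_in_S g_pos i by force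
  qed
qed

text \<open>By \<open>fold_sum_iff\<close> the order is the greatest length of a representation. It
  exists because \<open>len_le_val\<close> bounds all lengths, and this makes the description in
  \<open>sgp_ord\<close> well defined.\<close>

lemma
  shows ord_attained: "s \<in> S \<Longrightarrow> \<exists>l. val l = s \<and> len l = sgp_ord S s"
    and len_le_ord: "len l \<le> sgp_ord S (val l)"
proof -
  have *: "(\<exists>l. val l = s \<and> len l = sgp_ord S s) \<and> (\<forall>l. val l = s \<longrightarrow> len l \<le> sgp_ord S s)"
    if s: "s \<in> S" for s
  proof -
    obtain l0 where l0: "val l0 = s"
      using s by (auto simp: S_eq)
    have "len k \<le> s" if "val k = s" for k
      using len_le_val [of k] that by simp
    then have "\<exists>l. val l = s \<and> (\<forall>k. val k = s \<longrightarrow> len k \<le> len l)"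
      using l0 by (intro ex_has_greatest_nat [of _ l0 _ "Suc s"]) (auto simp: less_Suc_eq_le)
    then obtain l where l: "val l = s" "\<And>k. val k = s \<Longrightarrow> len k \<le> len l"
      by blast
    have "sgp_ord S s = len l"
      unfolding sgp_ord_def fold_sum_iff Diff_iff
    proof (rule the_equality)
      show "(\<exists>k. val k = s \<and> len l \<le> len k) \<and> \<not> (\<exists>k. val k = s \<and> len l + 1 \<le> len k)"
        using l by fastforce
      show "h = len l"
        if "(\<exists>k. val k = s \<and> h \<le> len k) \<and> \<not> (\<exists>k. val k = s \<and> h + 1 \<le> len k)" for h
        using that l by (metis Suc_eq_plus1 le_antisym le_trans not_less_eq_eq)
    qed
    then show ?thesis
      using l by auto
  qed
  show "s \<in> S \<Longrightarrow> \<exists>l. val l = s \<and> len l = sgp_ord S s" "len l \<le> sgp_ord S (val l)"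
    using * by auto
qed

text \<open>A longer representation of \<open>val a\<close> could replace \<open>a\<close> inside
  the sum and would lengthen the whole.\<close>

lemma maximal_part:
  assumes "len (\<lambda>i. a i + b i) = sgp_ord S (val (\<lambda>i. a i + b i))"
  shows "len a = sgp_ord S (val a)"
proof -
  obtain k where k: "val k = val a" "len k = sgp_ord S (val a)"
    using ord_attained by force
  have "len (\<lambda>i. k i + b i) \<le> sgp_ord S (val (\<lambda>i. a i + b i))"
    using len_le_ord [of "\<lambda>i. k i + b i"] k by (simp add: val_add)
  then show ?thesis
    using assms k len_le_ord [of a] by (simp add: len_add)
qed

subsection \<open>The Ap\'ery set\<close>

lemma apery_iff: "w \<in> apery S \<longleftrightarrow> w \<in> S \<and> (\<forall>s\<in>S. w \<noteq> s + m)"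
proof -
  have "int w - int m \<in> int ` S \<longleftrightarrow> (\<exists>s\<in>S. int w = int (s + m))"
    by (auto simp: image_iff algebra_simps)
  then show ?thesis
    unfolding apery_def by (auto simp only: of_nat_eq_iff mem_Collect_eq)
qed

text \<open>If \<open>x = s + m\<close>, then \<open>x + y = (s + y) + m\<close> would leave the
  Apery set.\<close>

lemma apery_summand:
  assumes "x + y \<in> apery S" "x \<in> S" "y \<in> S"
  shows "x \<in> apery S"
proof -
  have "s + y \<in> S" if "s \<in> S" for s
    using that assms S_add by blast
  then show ?thesis
    using assms by (fastforce simp: apery_iff)
qed

lemma add_mult_m: "x \<in> S \<Longrightarrow> x + k * m \<in> S"
proof (induction k)
  case (Suc k)
  then show ?case
    using S_add [OF Suc.IH m_in_S] by (simp add: algebra_simps)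
qed simp

text \<open>Of two elements of \<open>S\<close> in one residue class, the larger is the smaller plus
  a positive multiple of \<open>m\<close>, hence not in the Apery set. Conversely, the least element
  of \<open>S\<close> in a class is in it.\<close>

lemma bij_apery: "bij_betw (\<lambda>w. w mod m) (apery S) {..<m}"
  unfolding bij_betw_def
proof
  have le: "w' \<le> w" if w: "w \<in> apery S" "w' \<in> apery S" "w mod m = w' mod m" for w w'
  proof (rule ccontr)
    assume "\<not> w' \<le> w"
    then obtain q where q: "w' = w + m * q"
      using w(3) by (metis nat_le_linear mod_eq_nat1E)
    with \<open>\<not> w' \<le> w\<close> have "q \<noteq> 0"
      by (intro notI) simp
    then obtain k where "q = Suc k"
      by (cases q) auto
    then have "w' = (w + k * m) + m"
      using q by (simp add: algebra_simps)
    then show False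
      using w add_mult_m by (auto simp: apery_iff)
  qed
  then show "inj_on (\<lambda>w. w mod m) (apery S)"
    by (auto intro!: inj_onI le_antisym)
  show "(\<lambda>w. w mod m) ` apery S = {..<m}"
  proof
    show "(\<lambda>w. w mod m) ` apery S \<subseteq> {..<m}"
      using m_pos by auto
    show "{..<m} \<subseteq> (\<lambda>w. w mod m) ` apery S"
    proof
      fix r assume r: "r \<in> {..<m}"
      \<comment> \<open>\<open>N\<close> exceeds all gaps, so \<open>r + N * m\<close> shows that
        \<open>S\<close> meets the class of \<open>r\<close>.\<close>
      obtain N where N: "\<And>x. x \<notin> S \<Longrightarrow> x < N"
        using S_cofinite unfolding finite_nat_set_iff_bounded by auto
      have "N \<le> r + N * m"
        using m_pos by (simp add: trans_le_add2)
      then have ex: "r + N * m \<in> S \<and> (r + N * m) mod m = r"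
        using N [of "r + N * m"] r by (auto simp: not_less)
      define w where "w = (LEAST x. x \<in> S \<and> x mod m = r)"
      have w: "w \<in> S" "w mod m = r"
        using LeastI [of "\<lambda>x. x \<in> S \<and> x mod m = r", OF ex] by (auto simp: w_def)
      have "w \<noteq> s + m" if "s \<in> S" for s
      proof
        assume "w = s + m"
        moreover from this have "w \<le> s"
          using that w unfolding w_def by (intro Least_le) (auto simp: w_def [symmetric])
        ultimately show False
          using m_pos by simp
      qed
      then show "r \<in> (\<lambda>w. w mod m) ` apery S"
        using w by (auto simp: apery_iff)
    qed
  qed
qed

lemma card_apery: "card (apery S) = m"
  using bij_betw_same_card [OF bij_apery] by simp

lemma finite_apery: "finite (apery S)"
  using bij_betw_finite [OF bij_apery] by simp

section \<open>The Frobenius number as the maximum of the Apery set minus the multiplicity\<close>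

lemma
  shows frobenius_notin: "frobenius S \<notin> int ` S"
    and frobenius_upper: "z \<notin> int ` S \<Longrightarrow> z \<le> frobenius S"
proof -
  \<comment> \<open>The entry \<open>- 1\<close> stands for all negative integers and is the maximum
    when \<open>S\<close> has no gaps.\<close>
  define F where "F = insert (- 1) (int ` (UNIV - S))"
  have F: "finite F" "F \<noteq> {}"
    using S_cofinite by (auto simp: F_def)
  have "Max F \<in> F"
    using F by (rule Max_in)
  then have 1: "Max F \<notin> int ` S"
    by (auto simp: F_def)
  have 2: "z \<le> Max F" if "z \<notin> int ` S" for z
  proof (cases "z < 0")
    case True
    then show ?thesis
      using Max_ge [OF F(1), of "- 1"] by (simp add: F_def)
  next
    case False
    then have "z = int (nat z)"
      by simp
    then have "z \<in> F"
      using that unfolding F_def by blast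
    then show ?thesis
      using F by simp
  qed
  have "frobenius S = Max F"
    unfolding frobenius_def using 1 2 by (intro Greatest_equality)
  then show "frobenius S \<notin> int ` S" "z \<notin> int ` S \<Longrightarrow> z \<le> frobenius S"
    using 1 2 by auto
qed

text \<open>Being larger than the greatest gap, \<open>frobenius S + m\<close> lies in
  \<open>S\<close>; subtracting \<open>m\<close> gives that gap back.\<close>

lemma frobenius_apery: "\<exists>w\<in>apery S. frobenius S + int m = int w"
proof -
  have "frobenius S + int m \<in> int ` S"
    using frobenius_upper [of "frobenius S + int m"] m_pos by auto
  then obtain w where w: "w \<in> S" "frobenius S + int m = int w"
    by auto
  have "int w - int m \<notin> int ` S"
    using frobenius_notin unfolding w(2) [symmetric] by simp
  then show ?thesis
    using w by (intro bexI [of _ w]) (simp_all add: apery_def)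
qed

lemma apery_le_frobenius: "w \<in> apery S \<Longrightarrow> int w \<le> frobenius S + int m"
  using frobenius_upper [of "int w - int m"] by (simp add: apery_def)

subsection \<open>Maximal representations of greatest weight\<close>

text \<open>The multiple beyond the maximum \<open>c i\<close> violates one of the three conditions
  defining \<open>gamma\<close>. Two hold by assumption, so uniqueness fails, and a second
  representation of the same length must involve another generator.\<close>

lemma c_Suc_not_unique:
  assumes i: "i \<in> {2..n}"
    and h: "Suc (c i) * g i \<in> apery S" "sgp_ord S (Suc (c i) * g i) = Suc (c i)"
  shows "\<exists>k. val k = Suc (c i) * g i \<and> len k = Suc (c i) \<and> (\<exists>j\<in>{1..n}. j \<noteq> i \<and> k j \<noteq> 0)"
proof -
  have i1: "i \<in> {1..n}"
    using i by auto
  let ?u = "\<lambda>h. \<exists>!l. maximal_representation S g n (h * g i) l"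
  define A where "A = {h. h * g i \<in> apery S \<and> sgp_ord S (h * g i) = h \<and> ?u h}"
  have mr: "maximal_representation S g n s l \<longleftrightarrow>
      l \<in> {1..n} \<rightarrow>\<^sub>E UNIV \<and> s = val l \<and> len l = sgp_ord S s" for s l
    by (auto simp: maximal_representation_def representation_def val_def len_def)
  \<comment> \<open>Finiteness of \<open>A\<close> is what makes its \<open>Max\<close> an upper
    bound.\<close>
  have "A \<subseteq> (\<lambda>w. w div g i) ` apery S"
    using g_pos [OF i1] by (force simp: A_def image_iff)
  then have "finite A"
    using finite_apery finite_surj by blast
  then have "Suc (c i) \<notin> A"
    using Max_ge [of A "Suc (c i)"] unfolding gamma_def A_def by linarith
  then have nu: "\<not> ?u (Suc (c i))"
    using h by (simp add: A_def)
  define e where "e = restrict (\<lambda>j. if j = i then Suc (c i) else 0) {1..n}"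
  have e: "val e = Suc (c i) * g i" "len e = Suc (c i)"
    unfolding val_single [OF i1, symmetric] by (rule val_cong, simp add: e_def)
      (subst (2) len_single [OF i1, symmetric], rule len_cong, simp add: e_def)
  then have "maximal_representation S g n (Suc (c i) * g i) e"
    using h by (auto simp: mr e_def)
  with nu obtain k where k: "maximal_representation S g n (Suc (c i) * g i) k" "k \<noteq> e"
    by blast
  have kv: "val k = Suc (c i) * g i" "len k = Suc (c i)"
    using k(1) h by (auto simp: mr)
  have "\<exists>j\<in>{1..n}. j \<noteq> i \<and> k j \<noteq> 0"
  proof (rule ccontr)
    assume *: "\<not> ?thesis"
    then have "len k = len (\<lambda>j. if j = i then k i else 0)"
      by (intro len_cong) auto
    then have "k i = Suc (c i)"
      using kv len_single [OF i1] by simp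
    then have "k = e"
      using * k(1) unfolding e_def mr by (intro ext) (auto simp: PiE_def extensional_def)
    then show False
      using k by simp
  qed
  then show ?thesis
    using kv by blast
qed

text \<open>Expand the sum of \<open>k j * (g j - g i)\<^sup>2\<close>, which is positive because
  the generators are distinct. As \<open>val k = len k * g i\<close>, it collapses to
  \<open>weight k - len k * (g i)\<^sup>2\<close>.\<close>

lemma weight_increases:
  assumes i: "i \<in> {1..n}" and k: "val k = len k * g i"
    and j: "j \<in> {1..n}" "j \<noteq> i" "k j \<noteq> 0"
  shows "len k * (g i)\<^sup>2 < weight k"
proof -
  have eq: "int (k j) * (int (g j) - int (g i))\<^sup>2 =
      int (k j * (g j)\<^sup>2) - 2 * int (g i) * int (k j * g j) + (int (g i))\<^sup>2 * int (k j)" for j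
    by (simp add: power2_diff) (simp add: algebra_simps)
  have "0 < int (k j) * (int (g j) - int (g i))\<^sup>2"
    using j g_inj [OF j(1) i] by (auto simp: zero_less_mult_iff)
  also have "\<dots> \<le> (\<Sum>j=1..n. int (k j) * (int (g j) - int (g i))\<^sup>2)"
    using j by (intro member_le_sum) auto
  also have "\<dots> = (\<Sum>j=1..n. int (k j * (g j)\<^sup>2) - 2 * int (g i) * int (k j * g j) + (int (g i))\<^sup>2 * int (k j))"
    by (simp only: eq)
  also have "\<dots> = int (weight k) - 2 * int (g i) * int (val k) + (int (g i))\<^sup>2 * int (len k)"
    unfolding weight_def val_def len_def sum.distrib sum_subtractf sum_distrib_left [symmetric] of_nat_sum ..
  also have "\<dots> = int (weight k) - int (len k * (g i)\<^sup>2)"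
    by (simp add: k power2_eq_square)
  finally show ?thesis
    by linarith
qed

definition heaviest :: "(nat \<Rightarrow> nat) \<Rightarrow> bool" where
  "heaviest l \<longleftrightarrow> len l = sgp_ord S (val l) \<and>
     (\<forall>k. val k = val l \<and> len k = len l \<longrightarrow> weight k \<le> weight l)"

lemma heaviest_exists:
  assumes "s \<in> S"
  shows "\<exists>l. val l = s \<and> heaviest l"
proof -
  obtain l0 where "val l0 = s \<and> len l0 = sgp_ord S s"
    using ord_attained assms by blast
  moreover have "weight k \<le> s\<^sup>2" if "val k = s" for k
    using weight_le [of k] that by simp
  ultimately have "\<exists>l. (val l = s \<and> len l = sgp_ord S s) \<and>
      (\<forall>k. val k = s \<and> len k = sgp_ord S s \<longrightarrow> weight k \<le> weight l)"
    by (intro ex_has_greatest_nat [of _ l0 _ "Suc (s\<^sup>2)"]) (auto simp: less_Suc_eq_le)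
  then show ?thesis
    unfolding heaviest_def by metis
qed

text \<open>Since \<open>m = g 1\<close>, a positive first coefficient would allow \<open>m\<close>
  to be subtracted within \<open>S\<close>.\<close>

lemma apery_first_coeff:
  assumes "val l \<in> apery S"
  shows "l 1 = 0"
proof (rule ccontr)
  assume l: "l 1 \<noteq> 0"
  let ?e = "\<lambda>j. if j = 1 then 1 else 0 :: nat"
  have "val (\<lambda>j. l j - ?e j) + val ?e = val l"
    using l by (intro val_diff) auto
  then have "val l = val (\<lambda>j. l j - ?e j) + m"
    using n_pos val_single [of 1 1] by (simp add: multiplicity_eq)
  then show False
    using assms val_in_S unfolding apery_iff by blast
qed

lemma heaviest_bounded:
  assumes w: "val l \<in> apery S" and l: "heaviest l" and i: "i \<in> {2..n}"
  shows "l i \<le> c i"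
proof (rule ccontr)
  assume *: "\<not> l i \<le> c i"
  have i1: "i \<in> {1..n}"
    using i by auto
  define e where "e = (\<lambda>j. if j = i then Suc (c i) else 0)"
  define b where "b = (\<lambda>j. l j - e j)"
  have l_eq: "l = (\<lambda>j. e j + b j)"
    using * by (auto simp: e_def b_def)
  have e: "val e = Suc (c i) * g i" "len e = Suc (c i)" "weight e = Suc (c i) * (g i)\<^sup>2"
    unfolding e_def by (rule val_single len_single weight_single; fact)+
  \<comment> \<open>Both hypotheses of \<open>c_Suc_not_unique\<close> pass from \<open>l\<close> to
    its part \<open>e\<close>.\<close>
  have "val e \<in> apery S"
    using w by (intro apery_summand [of "val e" "val b"]) (simp_all add: l_eq val_add)
  moreover have "len e = sgp_ord S (val e)"
    using l by (intro maximal_part [of e b]) (simp add: heaviest_def l_eq)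
  ultimately obtain k j where k: "val k = val e" "len k = len e" "j \<in> {1..n}" "j \<noteq> i" "k j \<noteq> 0"
    using c_Suc_not_unique [OF i] e by metis
  then have "weight e < weight k"
    using weight_increases [OF i1, of k j] e by simp
  \<comment> \<open>Replacing \<open>e\<close> by \<open>k\<close> inside \<open>l\<close> keeps
    value and length, so \<open>l\<close> must still be at least as heavy.\<close>
  moreover have "weight (\<lambda>j. k j + b j) \<le> weight l"
    using l k unfolding heaviest_def by (auto simp: l_eq val_add len_add)
  ultimately show False
    by (simp add: l_eq weight_add)
qed

subsection \<open>The set of bounded combinations\<close>

definition box :: "(nat \<Rightarrow> nat) set" where "box = (\<Pi>\<^sub>E i\<in>{2..n}. {..c i})"

text \<open>Clearing the first coefficient brings sums over \<open>{2..n}\<close> under the results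
  on \<open>val\<close>.\<close>

lemma sum_eq_val: "(\<Sum>i=2..n. l i * g i) = val (l(1 := 0))"
proof -
  have "(\<Sum>i=2..n. l i * g i) = (\<Sum>i=2..n. (l(1 := 0)) i * g i)"
    by (intro sum.cong) auto
  also have "\<dots> = val (l(1 := 0))"
    unfolding val_def using n_pos by (intro sum.mono_neutral_left) auto
  finally show ?thesis .
qed

lemma Gamma_eq: "Gamma_set S g n = (\<lambda>l. val (l(1 := 0))) ` box"
proof -
  have "(\<Sum>i=2..n. l i * g i) \<in> (\<lambda>l. \<Sum>i=2..n. l i * g i) ` box"
    if "\<forall>i\<in>{2..n}. l i \<le> c i" for l
    using that by (intro image_eqI [of _ _ "restrict l {2..n}"]) (auto simp: box_def)
  then show ?thesis
    unfolding Gamma_set_def sum_eq_val [symmetric] by (auto simp: box_def PiE_iff)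
qed

lemma card_box: "card box = (\<Prod>i=2..n. c i + 1)" and finite_box: "finite box"
  unfolding box_def by (simp_all add: card_PiE finite_PiE)

lemma apery_subset_Gamma: "apery S \<subseteq> Gamma_set S g n"
proof
  fix w assume w: "w \<in> apery S"
  then obtain l where l: "val l = w" "heaviest l"
    using heaviest_exists by (auto simp: apery_iff)
  then have "w = (\<Sum>i=2..n. l i * g i)"
    using apery_first_coeff [of l] w by (simp add: sum_eq_val fun_upd_idem)
  moreover have "\<forall>i\<in>{2..n}. l i \<le> c i"
    using heaviest_bounded l w by blast
  ultimately show "w \<in> Gamma_set S g n"
    unfolding Gamma_set_def by blast
qed

lemma max_in_Gamma: "(\<Sum>i=2..n. c i * g i) \<in> Gamma_set S g n"
  unfolding Gamma_set_def by blast

lemma Gamma_le_max: "w \<in> Gamma_set S g n \<Longrightarrow> w \<le> (\<Sum>i=2..n. c i * g i)"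
  unfolding Gamma_set_def by (auto intro!: sum_mono)

text \<open>Each bounded combination is a summand of the top one, with complementary coefficients
  \<open>c i - l i\<close>.\<close>

lemma Gamma_subset_apery:
  assumes "(\<Sum>i=2..n. c i * g i) \<in> apery S"
  shows "Gamma_set S g n \<subseteq> apery S"
proof
  fix w assume "w \<in> Gamma_set S g n"
  then obtain l where l: "w = (\<Sum>i=2..n. l i * g i)" "\<forall>i\<in>{2..n}. l i \<le> c i"
    by (auto simp: Gamma_set_def)
  have "(\<Sum>i=2..n. l i * g i) + (\<Sum>i=2..n. (c i - l i) * g i) = (\<Sum>i=2..n. c i * g i)"
    using l by (simp add: sum.distrib [symmetric] distrib_right [symmetric])
  then have "w + (\<Sum>i=2..n. (c i - l i) * g i) \<in> apery S"
    using assms l by simp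
  then show "w \<in> apery S"
    by (rule apery_summand) (simp_all add: l sum_eq_val)
qed

lemma inj_on_box:
  assumes apery: "(\<Sum>i=2..n. c i * g i) \<in> apery S"
  shows "inj_on (\<lambda>l. val (l(1 := 0))) box"
proof -
  define t where "t = c(1 := 0)"
  have t: "val t \<in> apery S"
    using apery by (simp add: sum_eq_val t_def)
  \<comment> \<open>A heaviest representation of the top element is bounded by \<open>t\<close> in
    every coordinate; equal values and positive generators then force equality.\<close>
  have unique: "l i = t i" if l: "val l = val t" "heaviest l" "i \<in> {1..n}" for l i
  proof -
    have le: "l j \<le> t j" if "j \<in> {1..n}" for j
      using heaviest_bounded [of l j] apery_first_coeff [of l] l t that by (auto simp: t_def)
    have "val (\<lambda>j. t j - l j) = 0"
      using val_diff [of l t] le l by simp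
    then have "(t i - l i) * g i = 0"
      using l(3) term_le_val [of i "\<lambda>j. t j - l j"] by simp
    then show ?thesis
      using le [OF l(3)] g_pos [OF l(3)] by simp
  qed
  \<comment> \<open>Some heaviest representation exists and agrees with \<open>t\<close> on
    \<open>{1..n}\<close>, so \<open>t\<close> itself is heaviest.\<close>
  obtain l0 where l0: "val l0 = val t" "heaviest l0"
    using heaviest_exists by force
  have len0: "len l0 = len t" "weight l0 = weight t"
    using unique [OF l0] by (auto intro: len_cong weight_cong)
  then have ht: "heaviest t"
    using l0 by (simp add: heaviest_def)
  have le_t: "(l(1 := 0)) i \<le> t i" if "l \<in> box" "i \<in> {1..n}" for l i
    using that by (auto simp: box_def t_def PiE_iff)
  \<comment> \<open>As part of the maximal representation \<open>t\<close>, every vector of the box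
    has maximal length, so equal values imply equal lengths.\<close>
  have len_eq: "len (l(1 := 0)) = sgp_ord S (val (l(1 := 0)))" if "l \<in> box" for l
  proof (rule maximal_part [of _ "\<lambda>i. t i - (l(1 := 0)) i"])
    have "val (\<lambda>i. (l(1 := 0)) i + (t i - (l(1 := 0)) i)) = val t"
      "len (\<lambda>i. (l(1 := 0)) i + (t i - (l(1 := 0)) i)) = len t"
      by (rule val_cong len_cong; use le_t [OF that] in force)+
    then show "len (\<lambda>i. (l(1 := 0)) i + (t i - (l(1 := 0)) i))
        = sgp_ord S (val (\<lambda>i. (l(1 := 0)) i + (t i - (l(1 := 0)) i)))"
      using ht by (simp add: heaviest_def)
  qed
  have eq: "l = k"
    if l: "l \<in> box" and k: "k \<in> box" and v: "val (l(1 := 0)) = val (k(1 := 0))"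
      and q: "weight (l(1 := 0)) \<le> weight (k(1 := 0))" for l k
  proof -
    let ?l = "l(1 := 0)" and ?k = "k(1 := 0)"
    let ?d = "\<lambda>i. t i - ?l i"
    \<comment> \<open>Exchanging \<open>?l\<close> for the no lighter \<open>?k\<close> inside
      \<open>t\<close> yields another heaviest representation of the same element, which must be
      \<open>t\<close>.\<close>
    let ?r = "\<lambda>i. ?d i + ?k i"
    have d: "val ?d + val ?l = val t" "len ?d + len ?l = len t" "weight ?d + weight ?l = weight t"
      by (rule val_diff len_diff weight_diff; use le_t [OF l] in blast)+
    have len: "len ?l = len ?k"
      using len_eq l k v by simp
    have r: "val ?r = val t" "len ?r = len t" "weight t \<le> weight ?r"
      using d v len q by (simp_all only: val_add len_add weight_add)
    then have "heaviest ?r"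
      using ht unfolding heaviest_def by (auto intro: le_trans)
    then have "?r i = t i" if "i \<in> {1..n}" for i
      using unique [OF r(1)] that by simp
    then have lk: "?l i = ?k i" if "i \<in> {1..n}" for i
      using le_t [OF l that] that by (metis add_left_imp_eq le_add_diff_inverse2)
    have "l i = k i" if "i \<in> {2..n}" for i
      using lk [of i] that by simp
    then show "l = k"
      using l k unfolding box_def by (intro PiE_ext)
  qed
  show ?thesis
  proof (rule inj_onI)
    fix l k assume "l \<in> box" "k \<in> box" "val (l(1 := 0)) = val (k(1 := 0))"
    then show "l = k"
      using eq [of l k] eq [of k l] by (metis nat_le_linear)
  qed
qed

section \<open>The two equivalences, by comparing maxima and cardinalities\<close>

lemma gamma_rectangular_iff_frobenius:
  "gamma_rectangular S g n \<longleftrightarrow> frobenius S + int m = int (\<Sum>i=2..n. c i * g i)"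
proof
  assume "gamma_rectangular S g n"
  then have eq: "apery S = Gamma_set S g n"
    by (simp add: gamma_rectangular_def)
  obtain w where w: "w \<in> apery S" "frobenius S + int m = int w"
    using frobenius_apery by blast
  have "w \<le> (\<Sum>i=2..n. c i * g i)"
    using w eq Gamma_le_max by blast
  moreover have "int (\<Sum>i=2..n. c i * g i) \<le> int w"
    using apery_le_frobenius max_in_Gamma eq w by metis
  ultimately show "frobenius S + int m = int (\<Sum>i=2..n. c i * g i)"
    using w by linarith
next
  assume "frobenius S + int m = int (\<Sum>i=2..n. c i * g i)"
  then have "(\<Sum>i=2..n. c i * g i) \<in> apery S"
    using frobenius_apery by (metis of_nat_eq_iff)
  then show "gamma_rectangular S g n"
    using Gamma_subset_apery apery_subset_Gamma by (auto simp: gamma_rectangular_def)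
qed

lemma gamma_rectangular_iff_multiplicity:
  "gamma_rectangular S g n \<longleftrightarrow> m = (\<Prod>i=2..n. c i + 1)"
proof
  assume "gamma_rectangular S g n"
  then have eq: "apery S = Gamma_set S g n"
    by (simp add: gamma_rectangular_def)
  then have "inj_on (\<lambda>l. val (l(1 := 0))) box"
    using inj_on_box max_in_Gamma by simp
  then have "card (Gamma_set S g n) = card box"
    by (simp add: Gamma_eq card_image)
  then show "m = (\<Prod>i=2..n. c i + 1)"
    using card_apery eq card_box by simp
next
  assume m: "m = (\<Prod>i=2..n. c i + 1)"
  have fin: "finite (Gamma_set S g n)"
    by (simp add: Gamma_eq finite_box)
  \<comment> \<open>Here \<open>m\<close> is the size of the box, which maps onto
    \<open>Gamma_set S g n\<close>; with the inclusion of the Apery set this forces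
    equality.\<close>
  have "card (Gamma_set S g n) \<le> card (apery S)"
    using card_image_le [OF finite_box] unfolding Gamma_eq card_apery m card_box [symmetric] .
  then show "gamma_rectangular S g n"
    unfolding gamma_rectangular_def
    using card_seteq [OF fin apery_subset_Gamma] by simp
qed

end

theorem theorem2p22:
  fixes S :: "nat set" and g :: "nat \<Rightarrow> nat" and n :: nat
  assumes "numerical_semigroup S"
    and "strict_mono_on {1..n} g"
    and "minimally_generated S g n"
  shows "(gamma_rectangular S g n \<longleftrightarrow>
            frobenius S + int (sgp_multiplicity S) = int (\<Sum>i=2..n. gamma S g n i * g i)) \<and>
         (frobenius S + int (sgp_multiplicity S) = int (\<Sum>i=2..n. gamma S g n i * g i) \<longleftrightarrow>
            sgp_multiplicity S = (\<Prod>i=2..n. (gamma S g n i + 1)))"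
proof -
  interpret generated_semigroup S g n
    using assms by unfold_locales
  show ?thesis
    using gamma_rectangular_iff_frobenius gamma_rectangular_iff_multiplicity by simp
qed

end
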